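(* Let $k\ge 3$ be an integer, and let $G$ be a finite graph such that every edge of $G$ is contained in a cycle of length at most $k$. Let $A$ and $B$ be abelian groups of cardinality at least $k+1$. Then the diameter of $\mathcal{F}(G,A\times B)$ is at most $4|E(G)|$; in particular $\mathcal{F}(G,A\times B)$ is connected.
   Context: Graphs may have multiple edges but no loops. For a fixed orientation of $G$ and an abelian group $\Gamma$, a $\Gamma$-flow is a map $f:E(G)\to\Gamma$ such that at each vertex the sum of values on outgoing arcs equals the sum on incoming arcs; it is nowhere-zero if no edge receives $0_\Gamma$. A cycle is a connected 2-regular subgraph. $\mathcal{F}(G,\Gamma)$ is the graph whose vertices are the nowhere-zero $\Gamma$-flows of $G$, two flows $f,g$ adjacent iff $\{e:(f-g)(e)\ne0\}$ is the edge set of a cycle. The empty graph is considered connected (with diameter $0$). *)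

theory Defs
  imports
    "Graph_Theory.Graph_Theory"
    "HOL-Library.FuncSet"
    "HOL-Library.Product_Plus"
    "HOL-Library.Extended_Nat"
begin

text \<open>
  A multigraph together with a fixed orientation is a digraph whose arcs are the oriented edges;
  parallel and antiparallel arcs both stand for parallel edges. Notions that do not depend on the
  orientation (cycles, connectedness) are taken in the underlying undirected multigraph.
\<close>

text \<open>Flows live on the arcs only, hence the extensionality condition.\<close>

definition is_flow :: "('v, 'e) pre_digraph \<Rightarrow> ('e \<Rightarrow> 'c::ab_group_add) \<Rightarrow> bool" where
  "is_flow G f \<longleftrightarrow> f \<in> extensional (arcs G) \<and>
     (\<forall>v\<in>verts G. (\<Sum>e\<in>out_arcs G v. f e) = (\<Sum>e\<in>in_arcs G v. f e))"

definition nowhere_zero_flow :: "('v, 'e) pre_digraph \<Rightarrow> ('e \<Rightarrow> 'c::ab_group_add) \<Rightarrow> bool" where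
  "nowhere_zero_flow G f \<longleftrightarrow> is_flow G f \<and> (\<forall>e\<in>arcs G. f e \<noteq> 0)"

text \<open>
  A connected 2-regular subgraph of the underlying undirected multigraph. The undirected degree of a
  vertex in a loopless graph is the sum of its in- and out-degree, and \<^const>\<open>Digraph_Component.connected\<close>
  ignores orientations and requires a nonempty vertex set. Two parallel edges form a cycle of length 2.
\<close>

definition cycle_subgraph :: "('v, 'e) pre_digraph \<Rightarrow> ('v, 'e) pre_digraph \<Rightarrow> bool" where
  "cycle_subgraph C G \<longleftrightarrow> subgraph C G \<and> Digraph_Component.connected C \<and>
     (\<forall>v\<in>verts C. in_degree C v + out_degree C v = 2)"

text \<open>
  Simple undirected graphs are represented by symmetric digraphs whose arcs are pairs of vertices.
\<close>

definition flow_graph :: "('v, 'e) pre_digraph \<Rightarrow> 'c::ab_group_add itself \<Rightarrow>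
    ('e \<Rightarrow> 'c, ('e \<Rightarrow> 'c) \<times> ('e \<Rightarrow> 'c)) pre_digraph" where
  "flow_graph G _ = \<lparr>
     verts = {f. nowhere_zero_flow G f},
     arcs = {(f, g). nowhere_zero_flow G f \<and> nowhere_zero_flow G g \<and>
               (\<exists>C. cycle_subgraph C G \<and> {e \<in> arcs G. f e - g e \<noteq> 0} = arcs C)},
     tail = fst,
     head = snd\<rparr>"

lemma wf_digraph_flow_graph: "wf_digraph (flow_graph G T)"
  by unfold_locales (auto simp: flow_graph_def)

lemma symmetric_flow_graph:
  fixes G :: "('v, 'e) pre_digraph" and T :: "'c::ab_group_add itself"
  shows "symmetric (flow_graph G T)"
proof -
  have "{e \<in> arcs G. g e \<noteq> f e} = {e \<in> arcs G. f e \<noteq> g e}" for f g :: "'e \<Rightarrow> 'c"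
    by auto
  then show ?thesis
    by (simp add: symmetric_def arcs_ends_def arc_to_ends_def flow_graph_def sym_def image_iff) metis
qed

text \<open>
  In \<^typ>\<open>enat\<close> the infimum of the empty set is \<open>\<infinity>\<close> and the supremum of the empty set is \<open>0\<close>: vertices in
  different components have distance \<open>\<infinity>\<close>, and the empty graph has diameter \<open>0\<close>.
\<close>

definition graph_distance :: "('v, 'e) pre_digraph \<Rightarrow> 'v \<Rightarrow> 'v \<Rightarrow> enat" where
  "graph_distance H u v = (INF p\<in>{p. pre_digraph.awalk H u p v}. enat (length p))"

definition graph_diameter :: "('v, 'e) pre_digraph \<Rightarrow> enat" where
  "graph_diameter H = (SUP (u, v)\<in>verts H \<times> verts H. graph_distance H u v)"

lemma graph_diameter_empty: "verts H = {} \<Longrightarrow> graph_diameter H = 0"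
  by (simp add: graph_diameter_def bot_enat_def)

definition connected_or_empty :: "('v, 'e) pre_digraph \<Rightarrow> bool" where
  "connected_or_empty H \<longleftrightarrow> verts H = {} \<or> Digraph_Component.connected H"

end

theory Submission
  imports Defs
begin

text \<open>
  If \<open>f\<close> vanishes in the first coordinate at \<open>e\<close>, choose a cycle of length at most \<open>k\<close> through \<open>e\<close>.
  At most \<open>k\<close> values \<open>a \<in> A\<close> are forbidden if adding \<open>\<plusminus>a\<close> along the cycle is to make the first coordinate
  nonzero on the whole cycle, so some \<open>a\<close> works. Hence \<open>|E|\<close> steps turn \<open>f\<close> into a flow \<open>f\<^sub>1\<close> with
  nowhere-zero first coordinate, and likewise \<open>g\<close> into \<open>g\<^sub>1\<close> with nowhere-zero second coordinate.
  Every flow is a sum of at most \<open>|E|\<close> flows \<open>\<plusminus>a\<close> on cycles. Applied to the difference of the second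
  coordinates this leads from \<open>f\<^sub>1\<close> to \<open>(fst f\<^sub>1, snd g\<^sub>1)\<close>, applied to the difference of the first ones it
  leads on to \<open>g\<^sub>1\<close>, and nothing can become zero as the other coordinate is nowhere zero throughout.

  A graph with at least as many edges as vertices carries a nonzero integer flow, as one sees by
  contracting edges. This yields both the signs \<open>\<plusminus>\<close> along a given cycle and the existence of cycles.
\<close>

section \<open>Distance and diameter\<close>

context wf_digraph
begin

lemma graph_distance_le_enat_iff:
  "graph_distance G u v \<le> enat n \<longleftrightarrow> (\<exists>p. awalk u p v \<and> length p \<le> n)"
proof
  let ?L = "(\<lambda>p. enat (length p)) ` {p. awalk u p v}"
  assume le: "graph_distance G u v \<le> enat n"
  have "?L \<noteq> {}"
  proof
    assume "?L = {}"
    then have "graph_distance G u v = Inf {}"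
      unfolding graph_distance_def by simp
    with le show False
      by (simp add: Inf_enat_def)
  qed
  then have "Inf ?L \<in> ?L"
    unfolding Inf_enat_def by (auto intro: LeastI)
  with le show "\<exists>p. awalk u p v \<and> length p \<le> n"
    by (auto simp: graph_distance_def)
next
  assume "\<exists>p. awalk u p v \<and> length p \<le> n"
  then show "graph_distance G u v \<le> enat n"
    unfolding graph_distance_def by (auto intro: INF_lower2)
qed

lemma graph_distance_refl: "u \<in> verts G \<Longrightarrow> graph_distance G u u = 0"
  using graph_distance_le_enat_iff[of u u 0] by (simp add: awalk_Nil_iff flip: zero_enat_def)

lemma graph_distance_adjacent:
  assumes "u \<rightarrow>\<^bsub>G\<^esub> v"
  shows "graph_distance G u v \<le> 1"
proof -
  obtain e where "e \<in> arcs G" "tail G e = u" "head G e = v"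
    using assms by auto
  then have "awalk u [e] v"
    by (auto simp: awalk_simps)
  then show ?thesis
    unfolding one_enat_def graph_distance_le_enat_iff by force
qed

lemma graph_distance_triangle:
  "graph_distance G u w \<le> graph_distance G u v + graph_distance G v w"
proof (cases "graph_distance G u v"; cases "graph_distance G v w")
  fix m n assume mn: "graph_distance G u v = enat m" "graph_distance G v w = enat n"
  then obtain p q where "awalk u p v" "length p \<le> m" "awalk v q w" "length q \<le> n"
    by (metis graph_distance_le_enat_iff order_refl)
  then have "awalk u (p @ q) w" "length (p @ q) \<le> m + n"
    by auto
  then show ?thesis
    unfolding mn plus_enat_simps graph_distance_le_enat_iff by blast
qed auto

lemma graph_distance_descent:
  assumes "U \<subseteq> verts G" "u \<in> U"
    and step: "\<And>v. v \<in> U \<Longrightarrow> defect v \<noteq> 0 \<Longrightarrow> \<exists>w\<in>U. v \<rightarrow>\<^bsub>G\<^esub> w \<and> defect w < defect v"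
  shows "\<exists>v\<in>U. defect v = (0::nat) \<and> graph_distance G u v \<le> enat (defect u)"
  using \<open>u \<in> U\<close>
proof (induction "defect u" arbitrary: u rule: less_induct)
  case less
  show ?case
  proof (cases "defect u = 0")
    case True
    then show ?thesis
      using less.prems assms(1) by (auto intro!: bexI[of _ u] simp: graph_distance_refl)
  next
    case False
    then obtain w where w: "w \<in> U" "u \<rightarrow>\<^bsub>G\<^esub> w" "defect w < defect u"
      using step less.prems by blast
    then obtain v where v: "v \<in> U" "defect v = 0" "graph_distance G w v \<le> enat (defect w)"
      using less.hyps by blast
    have "graph_distance G u v \<le> graph_distance G u w + graph_distance G w v"
      by (rule graph_distance_triangle)
    also have "\<dots> \<le> 1 + enat (defect w)"
      using graph_distance_adjacent[OF w(2)] v(3) by (rule add_mono)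
    also have "\<dots> \<le> enat (defect u)"
      using w(3) by (simp add: one_enat_def)
    finally show ?thesis
      using v by blast
  qed
qed

lemma graph_distance_descent_sets:
  fixes D :: "'a \<Rightarrow> 'c set"
  assumes "finite A" "\<And>v. D v \<subseteq> A" "U \<subseteq> verts G" "u \<in> U"
    and step: "\<And>v. v \<in> U \<Longrightarrow> D v \<noteq> {} \<Longrightarrow> \<exists>w\<in>U. v \<rightarrow>\<^bsub>G\<^esub> w \<and> D w \<subset> D v"
  shows "\<exists>v\<in>U. D v = {} \<and> graph_distance G u v \<le> enat (card A)"
proof -
  have finite_D: "finite (D v)" for v
    using assms(2,1) by (rule finite_subset)
  have "\<exists>w\<in>U. v \<rightarrow>\<^bsub>G\<^esub> w \<and> card (D w) < card (D v)" if "v \<in> U" "card (D v) \<noteq> 0" for v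
  proof -
    have "D v \<noteq> {}"
      using that(2) by auto
    then show ?thesis
      using step[OF that(1)] finite_D psubset_card_mono by blast
  qed
  then obtain v where v: "v \<in> U" "card (D v) = 0" "graph_distance G u v \<le> enat (card (D u))"
    using graph_distance_descent[of U u "\<lambda>v. card (D v)"] assms(3,4) by blast
  note v(3)
  also have "enat (card (D u)) \<le> enat (card A)"
    using assms(1,2) by (simp add: card_mono)
  finally show ?thesis
    using v(1,2) finite_D by auto
qed

lemma connected_or_empty_if_diameter_le:
  assumes "graph_diameter G \<le> enat n"
  shows "connected_or_empty G"
proof -
  have "u \<rightarrow>\<^sup>*\<^bsub>mk_symmetric G\<^esub> v" if "u \<in> verts G" "v \<in> verts G" for u v
  proof -
    have "graph_distance G u v \<le> graph_diameter G"
      unfolding graph_diameter_def using that by (intro SUP_upper2[of "(u, v)"]) auto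
    also note assms
    finally obtain p where "awalk u p v"
      unfolding graph_distance_le_enat_iff by blast
    then show ?thesis
      by (intro reachable_mk_symmetricI reachable_awalkI)
  qed
  then show ?thesis
    unfolding connected_or_empty_def using connectedI by blast
qed

end

lemma (in sym_digraph) exists_reverse_awalk:
  "awalk u p v \<Longrightarrow> \<exists>q. awalk v q u \<and> length q = length p"
proof (induction p arbitrary: u)
  case Nil
  then show ?case
    by (auto simp: awalk_Nil_iff)
next
  case (Cons e p)
  then obtain q where q: "awalk v q (head G e)" "length q = length p"
    by (auto simp: awalk_Cons_iff)
  obtain e' where "e' \<in> arcs G" "tail G e' = head G e" "head G e' = u"
    using Cons.prems sym_arcs unfolding symmetric_conv awalk_Cons_iff by metis
  then have "awalk (head G e) [e'] u"
    by (auto simp: awalk_simps)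
  with q have "awalk v (q @ [e']) u" "length (q @ [e']) = length (e # p)"
    by auto
  then show ?case
    by blast
qed

lemma (in sym_digraph) graph_distance_sym: "graph_distance G u v = graph_distance G v u"
proof -
  have "graph_distance G u v \<le> graph_distance G v u" for u v
  proof (cases "graph_distance G v u")
    case (enat n)
    then obtain p where "awalk v p u" "length p \<le> n"
      by (metis graph_distance_le_enat_iff order_refl)
    then show ?thesis
      unfolding enat graph_distance_le_enat_iff using exists_reverse_awalk by metis
  qed auto
  then show ?thesis
    by (simp add: order_antisym)
qed

lemma graph_diameter_leI:
  "(\<And>u v. u \<in> verts H \<Longrightarrow> v \<in> verts H \<Longrightarrow> graph_distance H u v \<le> d) \<Longrightarrow> graph_diameter H \<le> d"
  unfolding graph_diameter_def by (auto intro: SUP_least)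

section \<open>Degrees and connectedness\<close>

definition degree :: "('v, 'e) pre_digraph \<Rightarrow> 'v \<Rightarrow> nat" where
  "degree G v = in_degree G v + out_degree G v"

abbreviation incident_arcs :: "('v, 'e) pre_digraph \<Rightarrow> 'v \<Rightarrow> 'e set" where
  "incident_arcs G v \<equiv> out_arcs G v \<union> in_arcs G v"

definition leafless :: "('v, 'e) pre_digraph \<Rightarrow> bool" where
  "leafless G \<longleftrightarrow> (\<forall>v. degree G v \<noteq> 1)"

lemma (in fin_digraph) handshake: "(\<Sum>v\<in>verts G. degree G v) = 2 * card (arcs G)"
proof -
  have "(\<Sum>v\<in>verts G. in_degree G v) = card (arcs G)"
    unfolding in_degree_def in_arcs_def card_eq_sum by (rule sum.group) auto
  moreover have "(\<Sum>v\<in>verts G. out_degree G v) = card (arcs G)"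
    unfolding out_degree_def out_arcs_def card_eq_sum by (rule sum.group) auto
  ultimately show ?thesis
    by (simp add: degree_def sum.distrib)
qed

definition adjacency_closed :: "('v, 'e) pre_digraph \<Rightarrow> 'v set \<Rightarrow> bool" where
  "adjacency_closed G R \<longleftrightarrow> (\<forall>e\<in>arcs G. tail G e \<in> R \<longleftrightarrow> head G e \<in> R)"

lemma verts_subset_adjacency_closed:
  assumes "Digraph_Component.connected G" "adjacency_closed G R" "u \<in> verts G" "u \<in> R"
  shows "verts G \<subseteq> R"
proof
  fix v assume "v \<in> verts G"
  then have "u \<rightarrow>\<^sup>*\<^bsub>mk_symmetric G\<^esub> v"
    using assms(1,3) unfolding Digraph_Component.connected_def strongly_connected_def by simp
  then have "(u, v) \<in> (parcs (mk_symmetric G))\<^sup>*"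
    using reachable_rtranclI by fastforce
  then show "v \<in> R"
    by (induction rule: rtrancl_induct)
      (use assms(2,4) in \<open>auto simp: adjacency_closed_def parcs_mk_symmetric\<close>)
qed

lemma (in wf_digraph) connectedI_adjacency_closed:
  assumes "verts G \<noteq> {}"
    and closed: "\<And>u R. u \<in> verts G \<Longrightarrow> u \<in> R \<Longrightarrow> adjacency_closed G R \<Longrightarrow> verts G \<subseteq> R"
  shows "Digraph_Component.connected G"
proof (rule connectedI[OF assms(1)])
  interpret S: pair_wf_digraph "mk_symmetric G" ..
  fix u v assume uv: "u \<in> verts G" "v \<in> verts G"
  have "adjacency_closed G {v. (u, v) \<in> (parcs (mk_symmetric G))\<^sup>*}"
    by (auto simp: adjacency_closed_def parcs_mk_symmetric intro: rtrancl_into_rtrancl)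
  then have "verts G \<subseteq> {v. (u, v) \<in> (parcs (mk_symmetric G))\<^sup>*}"
    using uv(1) by (intro closed) auto
  then have "(u, v) \<in> (parcs (mk_symmetric G))\<^sup>*"
    using uv(2) by blast
  then show "u \<rightarrow>\<^sup>*\<^bsub>mk_symmetric G\<^esub> v"
    using uv by (subst S.reachable_conv) auto
qed

section \<open>Net outflow\<close>

definition net_outflow :: "('v, 'e) pre_digraph \<Rightarrow> ('e \<Rightarrow> 'c::ab_group_add) \<Rightarrow> 'v \<Rightarrow> 'c" where
  "net_outflow G f v = (\<Sum>e\<in>out_arcs G v. f e) - (\<Sum>e\<in>in_arcs G v. f e)"

lemma net_outflow_cong:
  "(\<And>e. e \<in> arcs G \<Longrightarrow> f e = g e) \<Longrightarrow> net_outflow G f v = net_outflow G g v"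
  unfolding net_outflow_def by (auto intro!: arg_cong2[where f = minus] sum.cong)

lemma net_outflow_add:
  "net_outflow G (\<lambda>e. f e + g e) v = net_outflow G f v + net_outflow G g v"
  by (simp add: net_outflow_def sum.distrib)

lemma net_outflow_diff:
  "net_outflow G (\<lambda>e. f e - g e) v = net_outflow G f v - net_outflow G g v"
  by (simp add: net_outflow_def sum_subtractf)

lemma (in wf_digraph) net_outflow_outside_verts: "v \<notin> verts G \<Longrightarrow> net_outflow G f v = 0"
proof -
  assume "v \<notin> verts G"
  then have "out_arcs G v = {}" "in_arcs G v = {}"
    by auto
  then show ?thesis
    by (simp add: net_outflow_def)
qed

lemma (in wf_digraph) is_flow_iff_net_outflow:
  "is_flow G f \<longleftrightarrow> f \<in> extensional (arcs G) \<and> (\<forall>v. net_outflow G f v = 0)"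
  using net_outflow_outside_verts by (auto simp: is_flow_def net_outflow_def)

lemma (in fin_digraph) net_outflow_subgraph:
  assumes "subgraph H G" "\<And>e. e \<in> arcs G - arcs H \<Longrightarrow> f e = 0"
  shows "net_outflow G f v = net_outflow H f v"
proof -
  have "arcs H \<subseteq> arcs G" "tail H = tail G" "head H = head G"
    using assms(1) by (auto simp: compatible_def)
  then have "sum f (out_arcs G v) = sum f (out_arcs H v)" "sum f (in_arcs G v) = sum f (in_arcs H v)"
    using assms(2) by (auto intro!: sum.mono_neutral_right)
  then show ?thesis
    by (simp add: net_outflow_def)
qed

lemma (in fin_digraph) net_outflow_del_arc:
  assumes "e \<in> arcs G"
  shows "net_outflow G f v = net_outflow (del_arc e) f v
    + (if tail G e = v then f e else 0) - (if head G e = v then f e else 0)"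
proof -
  have "out_arcs (del_arc e) v = out_arcs G v - {e}" "in_arcs (del_arc e) v = in_arcs G v - {e}"
    by (auto simp: del_arc_def)
  then show ?thesis
    using assms by (simp add: net_outflow_def sum_diff1 finite_out_arcs finite_in_arcs)
qed

section \<open>Nonzero integer flows\<close>

definition contract_arc :: "('v, 'e) pre_digraph \<Rightarrow> 'e \<Rightarrow> ('v, 'e) pre_digraph" where
  "contract_arc G e = (let merge = (\<lambda>v. if v = head G e then tail G e else v) in
     \<lparr>verts = verts G - {head G e}, arcs = arcs G - {e}, tail = merge \<circ> tail G, head = merge \<circ> head G\<rparr>)"

context fin_digraph
begin

lemma fin_digraph_contract_arc:
  "e \<in> arcs G \<Longrightarrow> tail G e \<noteq> head G e \<Longrightarrow> fin_digraph (contract_arc G e)"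
  by unfold_locales (auto simp: contract_arc_def Let_def)

lemma net_outflow_contract_arc_tail:
  assumes "e \<in> arcs G" "tail G e \<noteq> head G e"
  shows "net_outflow (contract_arc G e) f (tail G e)
    = net_outflow (del_arc e) f (tail G e) + net_outflow (del_arc e) f (head G e)"
proof -
  have "out_arcs (contract_arc G e) (tail G e)
      = out_arcs (del_arc e) (tail G e) \<union> out_arcs (del_arc e) (head G e)"
    "in_arcs (contract_arc G e) (tail G e)
      = in_arcs (del_arc e) (tail G e) \<union> in_arcs (del_arc e) (head G e)"
    by (auto simp: contract_arc_def del_arc_def Let_def split: if_splits)
  moreover have "out_arcs (del_arc e) (tail G e) \<inter> out_arcs (del_arc e) (head G e) = {}"
    "in_arcs (del_arc e) (tail G e) \<inter> in_arcs (del_arc e) (head G e) = {}"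
    using assms(2) by (auto simp: del_arc_def)
  moreover have "finite (out_arcs (del_arc e) v)" "finite (in_arcs (del_arc e) v)" for v
    by (auto simp: out_arcs_def in_arcs_def del_arc_def)
  ultimately show ?thesis
    by (simp add: net_outflow_def sum.union_disjoint)
qed

lemma net_outflow_contract_arc_other:
  assumes "v \<noteq> tail G e" "v \<noteq> head G e"
  shows "net_outflow (contract_arc G e) f v = net_outflow (del_arc e) f v"
proof -
  have "out_arcs (contract_arc G e) v = out_arcs (del_arc e) v"
    "in_arcs (contract_arc G e) v = in_arcs (del_arc e) v"
    using assms by (auto simp: contract_arc_def del_arc_def Let_def)
  then show ?thesis
    by (simp add: net_outflow_def)
qed

text \<open>The value on the contracted arc is forced by conservation at its tail.\<close>

lemma net_outflow_extend_contract_arc: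
  fixes x :: "'b \<Rightarrow> 'c::ab_group_add"
  assumes "e \<in> arcs G" "tail G e \<noteq> head G e" "\<And>v. net_outflow (contract_arc G e) x v = 0"
  shows "net_outflow G (x(e := - net_outflow (del_arc e) x (tail G e))) v = 0"
proof -
  have x: "net_outflow (del_arc e) (x(e := a)) v = net_outflow (del_arc e) x v" for a v
    by (rule net_outflow_cong) (auto simp: del_arc_def)
  have "net_outflow (del_arc e) x (tail G e) + net_outflow (del_arc e) x (head G e) = 0"
    using assms net_outflow_contract_arc_tail by metis
  moreover have "net_outflow (del_arc e) x v = 0" if "v \<noteq> tail G e" "v \<noteq> head G e"
    using assms(3) that net_outflow_contract_arc_other by metis
  ultimately show ?thesis
    using assms(2) by (auto simp: net_outflow_del_arc[OF assms(1)] x add_eq_0_iff)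
qed

lemma card_contract_arc:
  assumes "e \<in> arcs G" "tail G e \<noteq> head G e"
  shows "card (arcs (contract_arc G e)) = card (arcs G) - 1"
    and "card (verts (contract_arc G e)) = card (verts G) - 1"
    and "2 \<le> card (verts G)"
proof -
  have "card {tail G e, head G e} \<le> card (verts G)"
    using assms(1) by (intro card_mono) auto
  then show "2 \<le> card (verts G)"
    using assms(2) by simp
qed (use assms(1) in \<open>simp_all add: contract_arc_def Let_def card_Diff_singleton\<close>)

lemma exists_nonzero_integer_flow_loop:
  assumes "e \<in> arcs G" "tail G e = head G e"
  shows "\<exists>x :: 'b \<Rightarrow> int. (\<exists>e\<in>arcs G. x e \<noteq> 0) \<and> (\<forall>v. net_outflow G x v = 0)"
proof -
  define x :: "'b \<Rightarrow> int" where "x = (\<lambda>e'. if e' = e then 1 else 0)"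
  have "net_outflow (del_arc e) x v = net_outflow (del_arc e) (\<lambda>_. 0) v" for v
    by (rule net_outflow_cong) (simp add: del_arc_def x_def)
  then have "net_outflow G x v = 0" for v
    using assms by (simp add: net_outflow_del_arc[OF assms(1)] net_outflow_def[of _ "\<lambda>_. 0"])
  then show ?thesis
    using assms(1) by (intro exI[of _ x]) (auto simp: x_def)
qed

end

lemma exists_nonzero_integer_flow:
  fixes G :: "('v, 'e) pre_digraph"
  assumes "fin_digraph G" "arcs G \<noteq> {}" "card (verts G) \<le> card (arcs G)"
  shows "\<exists>x :: 'e \<Rightarrow> int. (\<exists>e\<in>arcs G. x e \<noteq> 0) \<and> (\<forall>v. net_outflow G x v = 0)"
  using assms
proof (induction "card (arcs G)" arbitrary: G rule: less_induct)
  case less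
  interpret fin_digraph G by fact
  obtain e where e: "e \<in> arcs G"
    using less.prems by blast
  show ?case
  proof (cases "tail G e = head G e")
    case True
    with e show ?thesis
      by (rule exists_nonzero_integer_flow_loop)
  next
    case False
    let ?H = "contract_arc G e"
    have cards: "card (arcs ?H) < card (arcs G)" "card (arcs ?H) \<noteq> 0" "card (verts ?H) \<le> card (arcs ?H)"
      using card_contract_arc[OF e False] less.prems(3) by linarith+
    then have "arcs ?H \<noteq> {}"
      by auto
    then obtain x :: "'e \<Rightarrow> int"
      where "\<exists>e'\<in>arcs ?H. x e' \<noteq> 0" and x: "\<And>v. net_outflow ?H x v = 0"
      using less.hyps[OF cards(1) fin_digraph_contract_arc[OF e False]] cards(3) by blast
    then obtain e' where "e' \<in> arcs G" "e' \<noteq> e" "x e' \<noteq> 0"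
      by (auto simp: contract_arc_def Let_def)
    then show ?thesis
      using net_outflow_extend_contract_arc[OF e False x]
      by (intro exI[of _ "x(e := - net_outflow (del_arc e) x (tail G e))"]) auto
  qed
qed

section \<open>Loopfree graphs\<close>

locale fin_loopfree_digraph = fin_digraph G + loopfree_digraph G for G :: "('v, 'e) pre_digraph"
begin

lemma fin_loopfree_digraph_subgraph:
  assumes "subgraph H G"
  shows "fin_loopfree_digraph H"
proof -
  interpret H: fin_digraph H
    using assms by (rule fin_digraph_subgraph)
  show ?thesis
    by unfold_locales (metis assms compatible_def no_loops subgraph_def subsetD)
qed

lemma degree_eq_card_incident_arcs: "degree G v = card (incident_arcs G v)"
proof -
  have "out_arcs G v \<inter> in_arcs G v = {}"
    using no_loops by auto
  then show ?thesis
    by (simp add: degree_def in_degree_def out_degree_def card_Un_disjoint finite_in_arcs finite_out_arcs)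
qed

lemma leafless_nowhere_zero:
  assumes "\<And>v. net_outflow G f v = 0" "\<And>e. e \<in> arcs G \<Longrightarrow> f e \<noteq> 0"
  shows "leafless G"
  unfolding leafless_def
proof (intro allI notI)
  fix v assume "degree G v = 1"
  then obtain e where e: "incident_arcs G v = {e}"
    unfolding degree_eq_card_incident_arcs by (auto simp: card_1_singleton_iff)
  then have "e \<in> arcs G" "tail G e = v \<or> head G e = v"
    by (auto dest: equalityD2)
  then have "out_arcs G v = {e} \<and> in_arcs G v = {} \<or> out_arcs G v = {} \<and> in_arcs G v = {e}"
    using e no_loops by fastforce
  then have "f e = 0"
    using assms(1)[of v] by (auto simp: net_outflow_def)
  then show False
    using assms(2) \<open>e \<in> arcs G\<close> by blast
qed

lemma degree_2E:
  assumes "degree G v = 2"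
  obtains e\<^sub>1 e\<^sub>2 where "incident_arcs G v = {e\<^sub>1, e\<^sub>2}" "e\<^sub>1 \<noteq> e\<^sub>2"
  using assms unfolding degree_eq_card_incident_arcs by (auto simp: card_2_iff)

lemma net_outflow_two_arcs:
  assumes "incident_arcs G v = {e\<^sub>1, e\<^sub>2}" "e\<^sub>1 \<noteq> e\<^sub>2"
  shows "net_outflow G f v = 0 \<longleftrightarrow>
    (if (tail G e\<^sub>1 = v) = (tail G e\<^sub>2 = v) then f e\<^sub>1 = - f e\<^sub>2 else f e\<^sub>1 = f e\<^sub>2)"
proof -
  have "head G e \<noteq> tail G e" if "e \<in> arcs G" for e
    using no_loops[OF that] by simp
  then have "out_arcs G v = {e \<in> {e\<^sub>1, e\<^sub>2}. tail G e = v}"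
    "in_arcs G v = {e \<in> {e\<^sub>1, e\<^sub>2}. tail G e \<noteq> v}"
    unfolding assms(1)[symmetric] by auto
  then have "net_outflow G f v = (\<Sum>e\<in>{e\<^sub>1, e\<^sub>2}. if tail G e = v then f e else - f e)"
    by (simp add: net_outflow_def sum.If_cases Int_def sum_negf)
  also have "\<dots> = (if tail G e\<^sub>1 = v then f e\<^sub>1 else - f e\<^sub>1) + (if tail G e\<^sub>2 = v then f e\<^sub>2 else - f e\<^sub>2)"
    using assms(2) by simp
  finally show ?thesis
    by (auto simp: add_eq_0_iff equation_minus_iff[of "f e\<^sub>1" "f e\<^sub>2"]
        minus_equation_iff[of "f e\<^sub>2" "f e\<^sub>1"])
qed

lemma degree_2_flow_eq_0_iff:
  assumes "degree G v = 2" "net_outflow G f v = 0"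
    and "e \<in> incident_arcs G v" "e' \<in> incident_arcs G v"
  shows "f e = 0 \<longleftrightarrow> f e' = 0"
proof -
  obtain e\<^sub>1 e\<^sub>2 where inc: "incident_arcs G v = {e\<^sub>1, e\<^sub>2}" "e\<^sub>1 \<noteq> e\<^sub>2"
    using assms(1) by (rule degree_2E)
  have "f e\<^sub>1 = 0 \<longleftrightarrow> f e\<^sub>2 = 0"
    using assms(2) unfolding net_outflow_two_arcs[OF inc] by (auto split: if_splits)
  then show ?thesis
    using assms(3,4) unfolding inc(1) by auto
qed

end

section \<open>Signs along a cycle\<close>

definition signed :: "bool \<Rightarrow> 'c::ab_group_add \<Rightarrow> 'c" where
  "signed s a = (if s then a else - a)"

lemma signed_simps [simp]: "signed s a = 0 \<longleftrightarrow> a = 0" "signed s (signed s a) = a"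
  by (simp_all add: signed_def)

lemma additive_signed: "additive p \<Longrightarrow> p (signed s a) = signed s (p a)"
  by (simp add: signed_def additive.minus)

context fin_loopfree_digraph
begin

lemma exists_nowhere_zero_integer_flow_2_regular:
  assumes con: "Digraph_Component.connected G" and deg: "\<And>v. v \<in> verts G \<Longrightarrow> degree G v = 2"
  shows "\<exists>x :: 'e \<Rightarrow> int. (\<forall>e\<in>arcs G. x e \<noteq> 0) \<and> (\<forall>v. net_outflow G x v = 0)"
proof -
  have "verts G \<noteq> {}"
    using con by (auto simp: Digraph_Component.connected_def strongly_connected_def)
  moreover have same_card: "card (verts G) = card (arcs G)"
    using handshake deg by simp
  ultimately have "arcs G \<noteq> {}"
    by auto
  then obtain x :: "'e \<Rightarrow> int"
    where x: "\<exists>e\<in>arcs G. x e \<noteq> 0" and flow: "\<And>v. net_outflow G x v = 0"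
    using exists_nonzero_integer_flow[OF fin_digraph] same_card by auto
  define R where "R = {v. \<forall>e\<in>incident_arcs G v. x e \<noteq> 0}"
  have R_iff: "v \<in> R \<longleftrightarrow> x e \<noteq> 0"
    if "v \<in> verts G" "e \<in> incident_arcs G v" for v e
    using degree_2_flow_eq_0_iff[OF deg[OF that(1)] flow that(2)] that(2) unfolding R_def by blast
  have ends: "tail G e \<in> R \<longleftrightarrow> x e \<noteq> 0" "head G e \<in> R \<longleftrightarrow> x e \<noteq> 0" if "e \<in> arcs G" for e
    using that by (simp_all add: R_iff[of _ e])
  obtain e where "e \<in> arcs G" "x e \<noteq> 0"
    using x by blast
  then have "verts G \<subseteq> R"
    using con ends by (intro verts_subset_adjacency_closed[of G R "tail G e"])
      (auto simp: adjacency_closed_def)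
  then have "\<forall>e\<in>arcs G. x e \<noteq> 0"
    using ends(1) tail_in_verts by blast
  with flow show ?thesis
    by blast
qed

lemma exists_signed_flow_2_regular:
  assumes "Digraph_Component.connected G" and deg: "\<And>v. v \<in> verts G \<Longrightarrow> degree G v = 2"
  shows "\<exists>s. \<forall>(a :: 'c::ab_group_add) v. net_outflow G (\<lambda>e. signed (s e) a) v = 0"
proof -
  obtain x :: "'e \<Rightarrow> int" where nz: "\<And>e. e \<in> arcs G \<Longrightarrow> x e \<noteq> 0" and flow: "\<And>v. net_outflow G x v = 0"
    using exists_nowhere_zero_integer_flow_2_regular assms by blast
  have "net_outflow G (\<lambda>e. signed (x e > 0) a) v = 0" for a :: 'c and v
  proof (cases "v \<in> verts G")
    case True
    obtain e\<^sub>1 e\<^sub>2 where e: "incident_arcs G v = {e\<^sub>1, e\<^sub>2}" "e\<^sub>1 \<noteq> e\<^sub>2"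
      using deg[OF True] by (rule degree_2E)
    then have "e\<^sub>1 \<in> arcs G" "e\<^sub>2 \<in> arcs G"
      by auto
    then have "x e\<^sub>1 \<noteq> 0" "x e\<^sub>2 \<noteq> 0"
      by (simp_all add: nz)
    moreover have "if (tail G e\<^sub>1 = v) = (tail G e\<^sub>2 = v) then x e\<^sub>1 = - x e\<^sub>2 else x e\<^sub>1 = x e\<^sub>2"
      using flow[of v] unfolding net_outflow_two_arcs[OF e] .
    ultimately show ?thesis
      unfolding net_outflow_two_arcs[OF e] by (auto simp: signed_def split: if_splits)
  next
    case False
    then show ?thesis
      by (rule net_outflow_outside_verts)
  qed
  then show ?thesis
    by (intro exI[of _ "\<lambda>e. x e > 0"]) blast
qed

end

section \<open>Existence of cycles\<close>

definition arc_induced_subgraph :: "('v, 'e) pre_digraph \<Rightarrow> 'e set \<Rightarrow> ('v, 'e) pre_digraph" where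
  "arc_induced_subgraph G S = \<lparr>verts = tail G ` S \<union> head G ` S, arcs = S, tail = tail G, head = head G\<rparr>"

lemma arc_induced_subgraph_simps [simp]:
  "verts (arc_induced_subgraph G S) = tail G ` S \<union> head G ` S"
  "arcs (arc_induced_subgraph G S) = S"
  "tail (arc_induced_subgraph G S) = tail G"
  "head (arc_induced_subgraph G S) = head G"
  "arc_induced_subgraph (arc_induced_subgraph G S) T = arc_induced_subgraph G T"
  by (simp_all add: arc_induced_subgraph_def)

lemma (in wf_digraph) subgraph_arc_induced_subgraph:
  "S \<subseteq> arcs G \<Longrightarrow> subgraph (arc_induced_subgraph G S) G"
  by (rule subgraphI) (auto simp: compatible_def wf_digraph_axioms intro!: wf_digraph.intro)

definition minimal_leafless :: "('v, 'e) pre_digraph \<Rightarrow> bool" where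
  "minimal_leafless G \<longleftrightarrow> arcs G \<noteq> {} \<and> leafless G \<and>
     (\<forall>S. S \<subset> arcs G \<longrightarrow> S \<noteq> {} \<longrightarrow> \<not> leafless (arc_induced_subgraph G S))"

context fin_loopfree_digraph
begin

lemma leafless_support:
  assumes "\<And>v. net_outflow G f v = 0"
  shows "leafless (arc_induced_subgraph G {e \<in> arcs G. f e \<noteq> 0})"
proof -
  let ?H = "arc_induced_subgraph G {e \<in> arcs G. f e \<noteq> 0}"
  have sub: "subgraph ?H G"
    by (rule subgraph_arc_induced_subgraph) auto
  interpret H: fin_loopfree_digraph ?H
    using sub by (rule fin_loopfree_digraph_subgraph)
  have "net_outflow ?H f v = 0" for v
    using net_outflow_subgraph[OF sub, of f v] assms by simp
  then show ?thesis
    by (rule H.leafless_nowhere_zero) simp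
qed

text \<open>With more arcs than vertices, the support of a flow avoiding some arc would be smaller.\<close>

lemma minimal_leafless_card_arcs_le:
  assumes "minimal_leafless G"
  shows "card (arcs G) \<le> card (verts G)"
proof (rule ccontr)
  assume more: "\<not> card (arcs G) \<le> card (verts G)"
  obtain e where e: "e \<in> arcs G"
    using assms by (auto simp: minimal_leafless_def)
  then have "0 < card (verts G)"
    using card_gt_0_iff finite_verts tail_in_verts by blast
  have del: "arcs (del_arc e) = arcs G - {e}" "verts (del_arc e) = verts G"
    by (simp_all add: del_arc_def)
  have cards: "card (verts (del_arc e)) \<le> card (arcs (del_arc e))"
    using more e by (simp add: del card_Diff_singleton)
  moreover from this have "arcs (del_arc e) \<noteq> {}"
    using \<open>0 < card (verts G)\<close> unfolding del by (metis card.empty not_le)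
  ultimately obtain x :: "'e \<Rightarrow> int"
    where x: "\<exists>e'\<in>arcs G - {e}. x e' \<noteq> 0" "\<And>v. net_outflow (del_arc e) x v = 0"
    using exists_nonzero_integer_flow[OF fin_digraph_del_arc[of e]] unfolding del by blast
  have "net_outflow (del_arc e) (x(e := 0)) v = net_outflow (del_arc e) x v" for v
    by (rule net_outflow_cong) (auto simp: del)
  then have "net_outflow G (x(e := 0)) v = 0" for v
    using x(2) by (simp add: net_outflow_del_arc[OF e])
  then have "leafless (arc_induced_subgraph G {e' \<in> arcs G. (x(e := 0)) e' \<noteq> 0})"
    by (rule leafless_support)
  moreover have "{e' \<in> arcs G. (x(e := 0)) e' \<noteq> 0} \<subset> arcs G" "{e' \<in> arcs G. (x(e := 0)) e' \<noteq> 0} \<noteq> {}"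
    using e x(1) by auto
  ultimately show False
    using assms unfolding minimal_leafless_def by blast
qed

lemma minimal_leafless_2_regular:
  assumes "minimal_leafless G" and no_isolated: "\<And>v. v \<in> verts G \<Longrightarrow> degree G v \<noteq> 0"
    and v: "v \<in> verts G"
  shows "degree G v = 2"
proof (rule ccontr)
  assume "degree G v \<noteq> 2"
  have "2 \<le> degree G u" if "u \<in> verts G" for u
    using no_isolated[OF that] assms(1)
    by (metis One_nat_def less_2_cases_iff leafless_def minimal_leafless_def not_le)
  then have "(\<Sum>u\<in>verts G. 2) < (\<Sum>u\<in>verts G. degree G u)"
    using v \<open>degree G v \<noteq> 2\<close>
    by (intro sum_strict_mono_ex1) (auto intro!: bexI[of _ v] simp: le_neq_implies_less)
  then show False
    using handshake minimal_leafless_card_arcs_le[OF assms(1)] by simp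
qed

lemma minimal_leafless_connected:
  assumes min: "minimal_leafless G" and no_isolated: "\<And>v. v \<in> verts G \<Longrightarrow> degree G v \<noteq> 0"
  shows "Digraph_Component.connected G"
proof (rule connectedI_adjacency_closed)
  show "verts G \<noteq> {}"
    using min tail_in_verts unfolding minimal_leafless_def by blast
  fix u R assume u: "u \<in> verts G" "u \<in> R" and R: "adjacency_closed G R"
  define S where "S = {e \<in> arcs G. tail G e \<in> R}"
  let ?H = "arc_induced_subgraph G S"
  have "degree ?H v = (if v \<in> R then degree G v else 0)" for v
  proof -
    have "out_arcs ?H v = (if v \<in> R then out_arcs G v else {})"
      "in_arcs ?H v = (if v \<in> R then in_arcs G v else {})"
      using R by (auto simp: S_def adjacency_closed_def)
    then show ?thesis
      by (simp add: degree_def in_degree_def out_degree_def)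
  qed
  then have "leafless ?H"
    using min by (simp add: minimal_leafless_def leafless_def)
  have incident: "\<exists>e\<in>arcs G. v = tail G e \<or> v = head G e" if "v \<in> verts G" for v
    using no_isolated[OF that] unfolding degree_eq_card_incident_arcs by (auto simp: card_eq_0_iff)
  have in_S: "v \<in> R \<longleftrightarrow> e \<in> S" if "e \<in> arcs G" "v = tail G e \<or> v = head G e" for e v
    using that R by (auto simp: S_def adjacency_closed_def)
  have "S \<noteq> {}"
    using incident[OF u(1)] in_S u(2) by blast
  moreover have "S \<subseteq> arcs G"
    by (auto simp: S_def)
  ultimately have "S = arcs G"
    using min \<open>leafless ?H\<close> unfolding minimal_leafless_def by blast
  then show "verts G \<subseteq> R"
    using incident in_S by blast
qed

lemma exists_minimal_leafless_subgraph:
  assumes "leafless (arc_induced_subgraph G S)" "S \<subseteq> arcs G" "S \<noteq> {}"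
  shows "\<exists>T\<subseteq>S. minimal_leafless (arc_induced_subgraph G T)"
proof -
  define \<S> where "\<S> = {T. T \<subseteq> S \<and> T \<noteq> {} \<and> leafless (arc_induced_subgraph G T)}"
  have "finite S"
    using assms(2) finite_arcs by (rule finite_subset)
  then have "finite \<S>" "S \<in> \<S>"
    using assms by (auto simp: \<S>_def)
  then obtain T where "T \<in> \<S>" and min: "\<And>T'. T' \<in> \<S> \<Longrightarrow> T' \<subseteq> T \<Longrightarrow> T = T'"
    using finite_has_minimal2[of \<S> S] by blast
  then have T: "T \<subseteq> S" "T \<noteq> {}" "leafless (arc_induced_subgraph G T)"
    by (simp_all add: \<S>_def)
  have "\<not> leafless (arc_induced_subgraph G T')" if "T' \<subset> T" "T' \<noteq> {}" for T'
    using min[of T'] T(1) that unfolding \<S>_def by blast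
  then show ?thesis
    using T by (auto simp: minimal_leafless_def)
qed

lemma exists_cycle_in_support:
  assumes "\<And>v. net_outflow G f v = 0" "\<exists>e\<in>arcs G. f e \<noteq> 0"
  shows "\<exists>C. cycle_subgraph C G \<and> (\<forall>e\<in>arcs C. f e \<noteq> 0)"
proof -
  obtain T where T: "T \<subseteq> {e \<in> arcs G. f e \<noteq> 0}" "minimal_leafless (arc_induced_subgraph G T)"
    using exists_minimal_leafless_subgraph[OF leafless_support[OF assms(1)]] assms(2) by auto
  let ?C = "arc_induced_subgraph G T"
  have sub: "subgraph ?C G"
    using T(1) by (intro subgraph_arc_induced_subgraph) auto
  interpret C: fin_loopfree_digraph ?C
    using sub by (rule fin_loopfree_digraph_subgraph)
  have "degree ?C v \<noteq> 0" if "v \<in> verts ?C" for v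
    using that unfolding C.degree_eq_card_incident_arcs by (auto simp: card_eq_0_iff)
  then have "Digraph_Component.connected ?C" "\<And>v. v \<in> verts ?C \<Longrightarrow> degree ?C v = 2"
    using T(2) C.minimal_leafless_connected C.minimal_leafless_2_regular by blast+
  then have "cycle_subgraph ?C G"
    using sub by (simp add: cycle_subgraph_def degree_def)
  with T(1) show ?thesis
    by (intro exI[of _ ?C]) auto
qed

end

section \<open>Steps in the flow graph\<close>

lemma sym_digraph_flow_graph: "sym_digraph (flow_graph G T)"
  using wf_digraph_flow_graph symmetric_flow_graph by (rule wf_digraph.sym_digraphI)

lemma verts_flow_graph [simp]: "verts (flow_graph G T) = {f. nowhere_zero_flow G f}"
  by (simp add: flow_graph_def)

lemma dominates_flow_graph_iff:
  fixes f g :: "'e \<Rightarrow> 'c::ab_group_add"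
  shows "f \<rightarrow>\<^bsub>flow_graph G TYPE('c)\<^esub> g \<longleftrightarrow> nowhere_zero_flow G f \<and> nowhere_zero_flow G g \<and>
    (\<exists>C. cycle_subgraph C G \<and> {e \<in> arcs G. f e - g e \<noteq> 0} = arcs C)"
  by (auto simp: flow_graph_def arcs_ends_conv image_iff)

lemma exists_not_in_image:
  fixes h :: "'e \<Rightarrow> 'a"
  assumes "finite S" "infinite (UNIV :: 'a set) \<or> card S < card (UNIV :: 'a set)"
  shows "\<exists>a. a \<notin> h ` S"
proof (rule ccontr)
  assume "\<nexists>a. a \<notin> h ` S"
  then have "h ` S = UNIV"
    by blast
  then show False
    using assms card_image_le[of S h] finite_imageI[of S h] by simp
qed

context fin_loopfree_digraph
begin

definition shift_on_cycle ::
  "('v, 'e) pre_digraph \<Rightarrow> ('e \<Rightarrow> bool) \<Rightarrow> 'c \<Rightarrow> ('e \<Rightarrow> 'c) \<Rightarrow> 'e \<Rightarrow> 'c::ab_group_add" where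
  "shift_on_cycle C s a f = (\<lambda>e\<in>arcs G. f e + (if e \<in> arcs C then signed (s e) a else 0))"

lemma cycle_subgraph_arcs_subset: "cycle_subgraph C G \<Longrightarrow> arcs C \<subseteq> arcs G"
  by (auto simp: cycle_subgraph_def)

lemma cycle_subgraph_arcs_nonempty: "cycle_subgraph C G \<Longrightarrow> arcs C \<noteq> {}"
  by (fastforce simp: cycle_subgraph_def Digraph_Component.connected_def
      strongly_connected_def in_degree_def out_degree_def in_arcs_def out_arcs_def)

lemma exists_flow_shift_on_cycle:
  assumes "cycle_subgraph C G"
  shows "\<exists>s. \<forall>(a :: 'c::ab_group_add) f. is_flow G f \<longrightarrow> is_flow G (shift_on_cycle C s a f)"
proof -
  have sub: "subgraph C G" and con: "Digraph_Component.connected C"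
    and deg: "\<And>v. v \<in> verts C \<Longrightarrow> degree C v = 2"
    using assms by (auto simp: cycle_subgraph_def degree_def)
  interpret C: fin_loopfree_digraph C
    using sub by (rule fin_loopfree_digraph_subgraph)
  obtain s where s: "\<And>(a :: 'c) v. net_outflow C (\<lambda>e. signed (s e) a) v = 0"
    using C.exists_signed_flow_2_regular[OF con deg] by blast
  have "is_flow G (shift_on_cycle C s a f)" if f: "is_flow G f" for a :: 'c and f
  proof -
    let ?h = "\<lambda>e. if e \<in> arcs C then signed (s e) a else 0"
    have "net_outflow G (shift_on_cycle C s a f) v = 0" for v
    proof -
      have "net_outflow G (shift_on_cycle C s a f) v = net_outflow G (\<lambda>e. f e + ?h e) v"
        by (rule net_outflow_cong) (simp add: shift_on_cycle_def)
      also have "\<dots> = net_outflow G ?h v"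
        using f by (simp add: net_outflow_add is_flow_iff_net_outflow)
      also have "\<dots> = net_outflow C ?h v"
        using sub by (rule net_outflow_subgraph) simp
      also have "\<dots> = net_outflow C (\<lambda>e. signed (s e) a) v"
        by (rule net_outflow_cong) simp
      also have "\<dots> = 0"
        by (rule s)
      finally show ?thesis .
    qed
    then show ?thesis
      by (simp add: is_flow_iff_net_outflow shift_on_cycle_def)
  qed
  then show ?thesis
    by blast
qed

lemma dominates_shift_on_cycle:
  fixes f :: "'e \<Rightarrow> 'c::ab_group_add"
  assumes "cycle_subgraph C G" "a \<noteq> 0" "nowhere_zero_flow G f"
    and "nowhere_zero_flow G (shift_on_cycle C s a f)"
  shows "f \<rightarrow>\<^bsub>flow_graph G TYPE('c)\<^esub> shift_on_cycle C s a f"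
proof -
  have "{e \<in> arcs G. f e - shift_on_cycle C s a f e \<noteq> 0} = arcs C"
    using assms(2) cycle_subgraph_arcs_subset[OF assms(1)] by (auto simp: shift_on_cycle_def)
  then show ?thesis
    using assms unfolding dominates_flow_graph_iff by blast
qed

lemma exists_neighbour_nonzero_projection_on_cycle:
  fixes f :: "'e \<Rightarrow> 'c::ab_group_add" and p :: "'c \<Rightarrow> 'a::ab_group_add"
  assumes "additive p" "surj p"
    and C: "cycle_subgraph C G" "infinite (UNIV :: 'a set) \<or> card (arcs C) < card (UNIV :: 'a set)"
    and f: "nowhere_zero_flow G f" and e: "e \<in> arcs C" "p (f e) = 0"
  shows "\<exists>g. f \<rightarrow>\<^bsub>flow_graph G TYPE('c)\<^esub> g \<and> (\<forall>e\<in>arcs C. p (g e) \<noteq> 0) \<and>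
    (\<forall>e\<in>arcs G - arcs C. g e = f e)"
proof -
  interpret p: additive p by fact
  note CG = cycle_subgraph_arcs_subset[OF C(1)]
  then have "finite (arcs C)"
    using finite_arcs by (rule finite_subset)
  obtain s where s: "\<And>(a :: 'c) f. is_flow G f \<Longrightarrow> is_flow G (shift_on_cycle C s a f)"
    using exists_flow_shift_on_cycle[OF C(1)] by blast
  obtain a where a: "a \<notin> (\<lambda>e. signed (s e) (- p (f e))) ` arcs C"
    using exists_not_in_image[OF \<open>finite (arcs C)\<close> C(2)] by blast
  obtain b where b: "p b = a"
    using \<open>surj p\<close> by (metis surjD)
  let ?g = "shift_on_cycle C s b f"
  have on_C: "p (?g e) \<noteq> 0" if "e \<in> arcs C" for e
  proof
    assume "p (?g e) = 0"
    then have "p (f e) + signed (s e) a = 0"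
      using that CG by (auto simp: shift_on_cycle_def p.add additive_signed[OF \<open>additive p\<close>] b)
    then have "a = signed (s e) (- p (f e))"
      by (metis add_eq_0_iff signed_simps(2))
    then show False
      using a that by blast
  qed
  have off_C: "?g e = f e" if "e \<in> arcs G - arcs C" for e
    using that by (simp add: shift_on_cycle_def)
  have "a \<noteq> 0"
    using a e by (force simp: image_iff)
  then have "b \<noteq> 0"
    using b p.zero by auto
  moreover have "nowhere_zero_flow G ?g"
    using f s on_C off_C p.zero unfolding nowhere_zero_flow_def by (metis DiffI)
  ultimately have "f \<rightarrow>\<^bsub>flow_graph G TYPE('c)\<^esub> ?g"
    using C(1) f by (intro dominates_shift_on_cycle)
  with on_C off_C show ?thesis
    by blast
qed

lemma graph_distance_to_nowhere_zero_projection: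
  fixes f :: "'e \<Rightarrow> 'c::ab_group_add" and p :: "'c \<Rightarrow> 'a::ab_group_add"
  assumes "additive p" "surj p"
    and large: "infinite (UNIV :: 'a set) \<or> card (UNIV :: 'a set) \<ge> k + 1"
    and short: "\<forall>e\<in>arcs G. \<exists>C. cycle_subgraph C G \<and> e \<in> arcs C \<and> card (arcs C) \<le> k"
    and f: "nowhere_zero_flow G f"
  shows "\<exists>g. nowhere_zero_flow G g \<and> (\<forall>e\<in>arcs G. p (g e) \<noteq> 0) \<and>
    graph_distance (flow_graph G TYPE('c)) f g \<le> enat (card (arcs G))"
proof -
  let ?H = "flow_graph G TYPE('c)"
  interpret H: wf_digraph ?H by (rule wf_digraph_flow_graph)
  define Z where "Z g = {e \<in> arcs G. p (g e) = 0}" for g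
  have "\<exists>h\<in>verts ?H. g \<rightarrow>\<^bsub>?H\<^esub> h \<and> Z h \<subset> Z g" if g: "g \<in> verts ?H" and "Z g \<noteq> {}" for g
  proof -
    obtain e where e: "e \<in> arcs G" "p (g e) = 0"
      using \<open>Z g \<noteq> {}\<close> by (auto simp: Z_def)
    then obtain C where C: "cycle_subgraph C G" "e \<in> arcs C" "card (arcs C) \<le> k"
      using short by blast
    have "infinite (UNIV :: 'a set) \<or> card (arcs C) < card (UNIV :: 'a set)"
      using large C(3) by auto
    moreover have "nowhere_zero_flow G g"
      using g by simp
    ultimately obtain h
      where h: "g \<rightarrow>\<^bsub>?H\<^esub> h" "\<forall>e\<in>arcs C. p (h e) \<noteq> 0" "\<forall>e\<in>arcs G - arcs C. h e = g e"
      using exists_neighbour_nonzero_projection_on_cycle[OF assms(1,2) C(1)] C(2) e(2) by blast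
    then have "Z h \<subseteq> Z g" "e \<in> Z g - Z h"
      using e C(2) unfolding Z_def by force+
    with h(1) show ?thesis
      using H.adj_in_verts by blast
  qed
  then obtain g where "g \<in> verts ?H" "Z g = {}" "graph_distance ?H f g \<le> enat (card (arcs G))"
    using H.graph_distance_descent_sets[of "arcs G" Z "verts ?H" f] f by (auto simp: Z_def)
  then show ?thesis
    by (intro exI[of _ g]) (auto simp: Z_def)
qed

lemma exists_neighbour_closer:
  fixes f g :: "'e \<Rightarrow> 'c::ab_group_add" and p :: "'c \<Rightarrow> 'a::ab_group_add"
  assumes "additive p" "is_flow G f" "is_flow G g"
    and nonzero: "\<forall>e\<in>arcs G. p (g e) \<noteq> 0" and agree: "\<forall>e\<in>arcs G. p (f e) = p (g e)"
    and differ: "\<exists>e\<in>arcs G. f e \<noteq> g e"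
  shows "\<exists>h. f \<rightarrow>\<^bsub>flow_graph G TYPE('c)\<^esub> h \<and> (\<forall>e\<in>arcs G. p (h e) = p (g e)) \<and>
    {e \<in> arcs G. h e \<noteq> g e} \<subset> {e \<in> arcs G. f e \<noteq> g e}"
proof -
  interpret p: additive p by fact
  have "net_outflow G (\<lambda>e. f e - g e) v = 0" for v
    using assms(2,3) by (simp add: net_outflow_diff is_flow_iff_net_outflow)
  then obtain C where C: "cycle_subgraph C G" "\<forall>e\<in>arcs C. f e \<noteq> g e"
    using exists_cycle_in_support[of "\<lambda>e. f e - g e"] differ by auto
  note CG = cycle_subgraph_arcs_subset[OF C(1)]
  obtain s where s: "\<And>(a :: 'c) f. is_flow G f \<Longrightarrow> is_flow G (shift_on_cycle C s a f)"
    using exists_flow_shift_on_cycle[OF C(1)] by blast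
  obtain e where e: "e \<in> arcs C"
    using cycle_subgraph_arcs_nonempty[OF C(1)] by blast
  define a where "a = signed (s e) (g e - f e)"
  let ?h = "shift_on_cycle C s a f"
  have "p a = 0"
    using e CG agree by (auto simp: a_def additive_signed[OF \<open>additive p\<close>] p.diff)
  then have ph: "\<forall>e\<in>arcs G. p (?h e) = p (g e)"
    using agree by (simp add: shift_on_cycle_def p.add p.zero additive_signed[OF \<open>additive p\<close>])
  have "nowhere_zero_flow G f" "nowhere_zero_flow G ?h"
    using assms(2) s nonzero agree ph p.zero unfolding nowhere_zero_flow_def by metis+
  moreover have "a \<noteq> 0"
    using bspec[OF C(2) e] by (auto simp: a_def)
  ultimately have "f \<rightarrow>\<^bsub>flow_graph G TYPE('c)\<^esub> ?h"
    using C(1) by (intro dominates_shift_on_cycle)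
  moreover have "{e \<in> arcs G. ?h e \<noteq> g e} \<subset> {e \<in> arcs G. f e \<noteq> g e}"
  proof
    show "{e \<in> arcs G. ?h e \<noteq> g e} \<subseteq> {e \<in> arcs G. f e \<noteq> g e}"
      using C(2) by (auto simp: shift_on_cycle_def split: if_splits)
    have "?h e = g e"
      using e CG by (auto simp: shift_on_cycle_def a_def)
    then show "{e \<in> arcs G. ?h e \<noteq> g e} \<noteq> {e \<in> arcs G. f e \<noteq> g e}"
      using e C(2) CG by blast
  qed
  ultimately show ?thesis
    using ph by blast
qed

lemma graph_distance_same_nowhere_zero_projection:
  fixes f g :: "'e \<Rightarrow> 'c::ab_group_add" and p :: "'c \<Rightarrow> 'a::ab_group_add"
  assumes "additive p" "is_flow G f" "is_flow G g"
    and nonzero: "\<forall>e\<in>arcs G. p (g e) \<noteq> 0" and agree: "\<forall>e\<in>arcs G. p (f e) = p (g e)"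
  shows "graph_distance (flow_graph G TYPE('c)) f g \<le> enat (card (arcs G))"
proof -
  let ?H = "flow_graph G TYPE('c)"
  interpret H: wf_digraph ?H by (rule wf_digraph_flow_graph)
  define U where "U = {h. is_flow G h \<and> (\<forall>e\<in>arcs G. p (h e) = p (g e))}"
  define D where "D h = {e \<in> arcs G. h e \<noteq> g e}" for h
  have "U \<subseteq> verts ?H"
    using nonzero additive.zero[OF \<open>additive p\<close>] by (force simp: U_def nowhere_zero_flow_def)
  moreover have "f \<in> U"
    using assms(2) agree by (simp add: U_def)
  moreover have "\<exists>h'\<in>U. h \<rightarrow>\<^bsub>?H\<^esub> h' \<and> D h' \<subset> D h" if h: "h \<in> U" and "D h \<noteq> {}" for h
  proof -
    have "\<exists>e\<in>arcs G. h e \<noteq> g e"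
      using \<open>D h \<noteq> {}\<close> by (auto simp: D_def)
    then obtain h' where h': "h \<rightarrow>\<^bsub>?H\<^esub> h'" "\<forall>e\<in>arcs G. p (h' e) = p (g e)" "D h' \<subset> D h"
      using exists_neighbour_closer[OF assms(1) _ assms(3) nonzero, of h] h
      unfolding U_def D_def by blast
    then have "h' \<in> U"
      by (simp add: U_def dominates_flow_graph_iff nowhere_zero_flow_def)
    with h' show ?thesis
      by blast
  qed
  ultimately obtain h where h: "h \<in> U" "D h = {}" "graph_distance ?H f h \<le> enat (card (arcs G))"
    using H.graph_distance_descent_sets[of "arcs G" D U f] by (auto simp: D_def)
  have "h = g"
    using h(1,2) assms(3) by (intro extensionalityI[of _ "arcs G"]) (auto simp: U_def D_def is_flow_def)
  with h(3) show ?thesis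
    by simp
qed

lemma is_flow_fst_snd:
  fixes f g :: "'e \<Rightarrow> 'a::ab_group_add \<times> 'b::ab_group_add"
  assumes "is_flow G f" "is_flow G g"
  shows "is_flow G (\<lambda>e\<in>arcs G. (fst (f e), snd (g e)))"
  using assms by (auto simp: is_flow_def prod_eq_iff fst_sum snd_sum)

lemma flow_graph_prod_distance_le:
  fixes f g :: "'e \<Rightarrow> 'a::ab_group_add \<times> 'b::ab_group_add"
  assumes short: "\<forall>e\<in>arcs G. \<exists>C. cycle_subgraph C G \<and> e \<in> arcs C \<and> card (arcs C) \<le> k"
    and large: "infinite (UNIV :: 'a set) \<or> card (UNIV :: 'a set) \<ge> k + 1"
      "infinite (UNIV :: 'b set) \<or> card (UNIV :: 'b set) \<ge> k + 1"
    and f: "nowhere_zero_flow G f" and g: "nowhere_zero_flow G g"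
  shows "graph_distance (flow_graph G TYPE('a \<times> 'b)) f g \<le> enat (4 * card (arcs G))"
proof -
  let ?H = "flow_graph G TYPE('a \<times> 'b)" and ?m = "enat (card (arcs G))"
  interpret H: sym_digraph ?H by (rule sym_digraph_flow_graph)
  have fst: "additive (fst :: 'a \<times> 'b \<Rightarrow> 'a)" and snd: "additive (snd :: 'a \<times> 'b \<Rightarrow> 'b)"
    by (auto simp: additive_def)
  obtain f\<^sub>1
    where f\<^sub>1: "nowhere_zero_flow G f\<^sub>1" "\<forall>e\<in>arcs G. fst (f\<^sub>1 e) \<noteq> 0" "graph_distance ?H f f\<^sub>1 \<le> ?m"
    using graph_distance_to_nowhere_zero_projection[OF fst range_fst large(1) short f] by blast
  obtain g\<^sub>1
    where g\<^sub>1: "nowhere_zero_flow G g\<^sub>1" "\<forall>e\<in>arcs G. snd (g\<^sub>1 e) \<noteq> 0" "graph_distance ?H g g\<^sub>1 \<le> ?m"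
    using graph_distance_to_nowhere_zero_projection[OF snd range_snd large(2) short g] by blast
  have flows: "is_flow G f\<^sub>1" "is_flow G g\<^sub>1"
    using f\<^sub>1 g\<^sub>1 by (auto simp: nowhere_zero_flow_def)
  define h where "h = (\<lambda>e\<in>arcs G. (fst (f\<^sub>1 e), snd (g\<^sub>1 e)))"
  have h: "is_flow G h"
    unfolding h_def by (rule is_flow_fst_snd[OF flows])
  have "graph_distance ?H f\<^sub>1 h \<le> ?m"
    using f\<^sub>1(2)
    by (intro graph_distance_same_nowhere_zero_projection[OF fst flows(1) h]) (simp_all add: h_def)
  moreover have "graph_distance ?H h g\<^sub>1 \<le> ?m"
    using g\<^sub>1(2)
    by (intro graph_distance_same_nowhere_zero_projection[OF snd h flows(2)]) (simp_all add: h_def)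
  moreover have "graph_distance ?H g\<^sub>1 g \<le> ?m"
    using g\<^sub>1(3) H.graph_distance_sym by metis
  ultimately have "graph_distance ?H f g \<le> ?m + (?m + (?m + ?m))"
    using f\<^sub>1(3) by (meson H.graph_distance_triangle add_mono order_trans)
  also have "\<dots> = enat (4 * card (arcs G))"
    by simp
  finally show ?thesis .
qed

end

theorem theorem6p4:
  fixes G :: "('v, 'e) pre_digraph"
    and k :: nat
  assumes "k \<ge> 3"
    and "fin_digraph G"
    and "loopfree_digraph G"
    and "\<forall>e\<in>arcs G. \<exists>C. cycle_subgraph C G \<and> e \<in> arcs C \<and> card (arcs C) \<le> k"
    and "infinite (UNIV :: 'a::ab_group_add set) \<or> card (UNIV :: 'a set) \<ge> k + 1"
    and "infinite (UNIV :: 'b::ab_group_add set) \<or> card (UNIV :: 'b set) \<ge> k + 1"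
  shows "graph_diameter (flow_graph G TYPE('a \<times> 'b)) \<le> enat (4 * card (arcs G)) \<and>
         connected_or_empty (flow_graph G TYPE('a \<times> 'b))"
proof -
  interpret fin_loopfree_digraph G
    using assms(2,3) by (rule fin_loopfree_digraph.intro)
  have "graph_diameter (flow_graph G TYPE('a \<times> 'b)) \<le> enat (4 * card (arcs G))"
    using flow_graph_prod_distance_le[OF assms(4-6)] by (intro graph_diameter_leI) simp
  moreover from this have "connected_or_empty (flow_graph G TYPE('a \<times> 'b))"
    by (rule wf_digraph.connected_or_empty_if_diameter_le[OF wf_digraph_flow_graph])
  ultimately show ?thesis
    by blast
qed

end
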